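(* Let $X$ and $Y$ be reflexive and strictly convex real Banach spaces, let $A\colon X\to Y$ be a bounded linear operator, and let $p,q\ge1$. For $y\in Y$ and $\alpha>0$ let $x_\alpha(y)$ be the minimizer over $x\in X$ of the Tikhonov functional $T_\alpha(x,y)=\|Ax-y\|_Y^p+\alpha\|x\|_X^q$. If $y\in C_Y(A)$, then $x_\alpha(y)=0$ for all $\alpha>0$.
   Context: $\mathcal R(A)\subset Y$ is the (not necessarily closed) range of $A$. The duality map of $Y$ is $J_Y(y)=\{y'\in Y':\langle y',y\rangle=\|y\|_Y^2=\|y'\|_{Y'}^2\}$, and $C_Y(A)=J_Y^{-1}(\mathcal R(A)^\perp)=\{y\in Y:J_Y(y)\cap\mathcal R(A)^\perp\neq\emptyset\}$, where $\mathcal R(A)^\perp\subset Y'$ is the annihilator of $\mathcal R(A)$. Equivalently, $C_Y(A)$ is the set of $y\in Y$ with $\pi_{\overline{\mathcal R(A)}}y=0$, where $\pi_{\overline{\mathcal R(A)}}$ is the metric projection onto $\overline{\mathcal R(A)}$, mapping $y$ to the unique element of $\overline{\mathcal R(A)}$ nearest to $y$. *)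

theory Defs
  imports "HOL-Analysis.Analysis"
begin

type_synonym 'a dual = "'a \<Rightarrow>\<^sub>L real"

text \<open>The first argument of the next two predicates only selects the space.
  Reflexivity is surjectivity of the canonical embedding into the bidual.\<close>

definition reflexive_space :: "'a::banach itself \<Rightarrow> bool" where
  "reflexive_space _ \<longleftrightarrow>
     (\<forall>\<phi> :: 'a dual dual. \<exists>x::'a. \<forall>f :: 'a dual. blinfun_apply \<phi> f = blinfun_apply f x)"

definition strictly_convex_space :: "'a::banach itself \<Rightarrow> bool" where
  "strictly_convex_space _ \<longleftrightarrow>
     (\<forall>x y :: 'a. norm x = 1 \<longrightarrow> norm y = 1 \<longrightarrow> x \<noteq> y \<longrightarrow> norm (x + y) < 2)"

definition duality_map :: "'b::real_normed_vector \<Rightarrow> 'b dual set" where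
  "duality_map y = {f. blinfun_apply f y = (norm y)\<^sup>2 \<and> (norm y)\<^sup>2 = (norm f)\<^sup>2}"

definition annihilator :: "'b::real_normed_vector set \<Rightarrow> 'b dual set" where
  "annihilator S = {f. \<forall>y\<in>S. blinfun_apply f y = 0}"

text \<open>The preimage, under the set-valued duality map, of the annihilator of the range.\<close>

definition null_cone :: "('a::real_normed_vector \<Rightarrow>\<^sub>L 'b::real_normed_vector) \<Rightarrow> 'b set" where
  "null_cone A = {y. duality_map y \<inter> annihilator (range (blinfun_apply A)) \<noteq> {}}"

definition tikhonov ::
  "('a::real_normed_vector \<Rightarrow>\<^sub>L 'b::real_normed_vector) \<Rightarrow> real \<Rightarrow> real \<Rightarrow> real \<Rightarrow> 'b \<Rightarrow> 'a \<Rightarrow> real" where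
  "tikhonov A p q \<alpha> y x = norm (blinfun_apply A x - y) powr p + \<alpha> * norm x powr q"

abbreviation is_tikhonov_minimizer ::
  "('a::real_normed_vector \<Rightarrow>\<^sub>L 'b::real_normed_vector) \<Rightarrow> real \<Rightarrow> real \<Rightarrow> real \<Rightarrow> 'b \<Rightarrow> 'a \<Rightarrow> bool" where
  "is_tikhonov_minimizer A p q \<alpha> y \<equiv> is_arg_min (tikhonov A p q \<alpha> y) (\<lambda>_. True)"

text \<open>For \<open>p = q = 1\<close> and general \<open>y\<close> there may be several minimizers; the value is
  meaningful as ``the'' minimizer only together with existence and uniqueness.\<close>

definition tikhonov_minimizer ::
  "('a::real_normed_vector \<Rightarrow>\<^sub>L 'b::real_normed_vector) \<Rightarrow> real \<Rightarrow> real \<Rightarrow> real \<Rightarrow> 'b \<Rightarrow> 'a" where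
  "tikhonov_minimizer A p q \<alpha> y = (THE x. is_tikhonov_minimizer A p q \<alpha> y x)"

end

theory Submission imports Defs begin

text \<open>A functional in the duality map of \<open>y\<close> that annihilates the range of \<open>A\<close> takes the same
  value on \<open>y\<close> and on every \<open>y - A x\<close>, which shows that \<open>0\<close> is a best approximation of \<open>y\<close> in
  the range (\<open>null_cone_norm_le\<close>). So the data term of the Tikhonov functional is already
  smallest at \<open>x = 0\<close>, while the penalty is strictly smaller at \<open>0\<close> than anywhere else. Hence
  \<open>0\<close> is the unique minimizer.\<close>

text \<open>The duality map gives a functional \<open>f\<close> of norm \<open>norm y\<close> that vanishes on the range, so that
  \<open>(norm y)\<^sup>2 = f y = f (y - A x) \<le> norm y * norm (y - A x)\<close>.\<close>

lemma null_cone_norm_le: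
  fixes A :: "'a::real_normed_vector \<Rightarrow>\<^sub>L 'b::real_normed_vector"
  assumes "y \<in> null_cone A"
  shows "norm y \<le> norm (blinfun_apply A x - y)"
proof -
  obtain f where fy: "blinfun_apply f y = (norm y)\<^sup>2" and nf: "(norm y)\<^sup>2 = (norm f)\<^sup>2"
    and fA: "blinfun_apply f (blinfun_apply A x) = 0"
    using assms unfolding null_cone_def duality_map_def annihilator_def by blast
  have "norm f = norm y"
    using nf by simp
  have "norm y * norm y = \<bar>blinfun_apply f (blinfun_apply A x - y)\<bar>"
    by (simp add: blinfun.diff_right fy fA power2_eq_square)
  also have "\<dots> \<le> norm y * norm (blinfun_apply A x - y)"
    using norm_blinfun[of f "blinfun_apply A x - y"] by (simp add: \<open>norm f = norm y\<close>)
  finally show ?thesis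
    by (cases "y = 0") auto
qed

lemma tikhonov_zero_less:
  fixes A :: "'a::real_normed_vector \<Rightarrow>\<^sub>L 'b::real_normed_vector"
  assumes "y \<in> null_cone A" and "p \<ge> 0" and "\<alpha> > 0" and "x \<noteq> 0"
  shows "tikhonov A p q \<alpha> y 0 < tikhonov A p q \<alpha> y x"
proof -
  have "norm y powr p \<le> norm (blinfun_apply A x - y) powr p"
    using null_cone_norm_le[OF assms(1)] \<open>p \<ge> 0\<close> by (intro powr_mono2) auto
  moreover have "0 < \<alpha> * norm x powr q"
    using assms by simp
  ultimately show ?thesis
    by (simp add: tikhonov_def)
qed

theorem proposition3:
  fixes A :: "'a::banach \<Rightarrow>\<^sub>L 'b::banach" and p q :: real and y :: 'b
  assumes "reflexive_space TYPE('a)" and "strictly_convex_space TYPE('a)"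
    and "reflexive_space TYPE('b)" and "strictly_convex_space TYPE('b)"
    and "p \<ge> 1" and "q \<ge> 1"
    and "y \<in> null_cone A"
  shows "\<forall>\<alpha>>0. (\<exists>!x. is_tikhonov_minimizer A p q \<alpha> y x) \<and> tikhonov_minimizer A p q \<alpha> y = 0"
proof (intro allI impI)
  fix \<alpha> :: real
  assume "\<alpha> > 0"
  have less: "tikhonov A p q \<alpha> y 0 < tikhonov A p q \<alpha> y x" if "x \<noteq> 0" for x
    using tikhonov_zero_less[of y A p \<alpha> x q] assms(5,7) \<open>\<alpha> > 0\<close> that by simp
  have iff: "is_tikhonov_minimizer A p q \<alpha> y x \<longleftrightarrow> x = 0" for x
    unfolding is_arg_min_def using less by (metis less_asym less_irrefl)
  show "(\<exists>!x. is_tikhonov_minimizer A p q \<alpha> y x) \<and> tikhonov_minimizer A p q \<alpha> y = 0"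
    by (simp add: iff tikhonov_minimizer_def)
qed

end
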